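(* Let $0<p<1$, $q=1-p$, let $S_n$ denote the stratum number of the tree generated by the $n$th iteration of the algorithm, and let $P^{\langle 0\rangle}(z)=\sum_{n\ge0}\mathbb{P}\{S_n=0\}z^n$. The generating function $\mu(z)=\sum_{n\ge0}\mathbb{E}[S_n]z^n$ is $$\mu(z)=\frac{qzP^{\langle 0\rangle}(z)}{1-z}+\frac{(p-q)z}{(1-z)^2}.$$ Moreover, as $n\to\infty$, $\mu_n=\mathbb{E}[S_n]$ satisfies, for every $\varepsilon>0$, $$\mu_n=\begin{cases}\dfrac{p}{q-p}+O\big((2\sqrt{pq}+\varepsilon)^n\big), & p<\frac12,\\[2mm] \sqrt{\dfrac{2n}{\pi}}-\dfrac12+O(n^{-1/2}), & p=\frac12,\\[2mm] (p-q)n+\dfrac{q}{p-q}+O\big((2\sqrt{pq}+\varepsilon)^n\big), & p>\frac12.\end{cases}$$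
   Context: The stratum number of a tree is its number of nodes minus one. A random tree starts as a single node at time $0$; at each time step a node is added with probability $p$ or deleted with probability $q=1-p$, except that a single-node tree is left unchanged instead of undergoing deletion. Thus the stratum number $S_n$ after $n$ iterations is the Markov chain on $\{0,1,2,\dots\}$ with $S_0=0$ and transitions $k\to k+1$ with probability $p$ (all $k\ge0$), $k\to k-1$ with probability $q$ (for $k\ge1$), and $0\to0$ with probability $q$. Generating function identities are as formal power series in $z$. *)

theory Defs
  imports
    "HOL-Probability.Probability"
    "HOL-Computational_Algebra.Formal_Power_Series"
    "HOL-Library.Landau_Symbols"
begin

text \<open>
  A state is a stratum number, i.e. the number of nodes of the tree minus one. A deletion applied
  to the single-node tree (state 0) leaves it unchanged.
\<close>

definition stratum_transition :: "real \<Rightarrow> nat \<Rightarrow> nat \<Rightarrow> real" where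
  "stratum_transition p k j =
     (if j = k + 1 then p
      else if (k \<ge> 1 \<and> k = j + 1) \<or> (k = 0 \<and> j = 0) then 1 - p
      else 0)"

text \<open>
  The Markov property is stated with respect to the full history, and only for histories
  of positive probability, since \<^const>\<open>cond_prob\<close> is a quotient.
\<close>

definition stratum_chain :: "'a measure \<Rightarrow> real \<Rightarrow> (nat \<Rightarrow> 'a \<Rightarrow> nat) \<Rightarrow> bool" where
  "stratum_chain M p S \<longleftrightarrow>
     prob_space M \<and>
     (\<forall>n. S n \<in> measurable M (count_space UNIV)) \<and>
     (AE \<omega> in M. S 0 \<omega> = 0) \<and>
     (\<forall>n x j. \<P>(\<omega> in M. \<forall>i\<le>n. S i \<omega> = x i) > 0 \<longrightarrow>
        \<P>(\<omega> in M. S (Suc n) \<omega> = j \<bar> \<forall>i\<le>n. S i \<omega> = x i) = stratum_transition p (x n) j)"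

definition stratum_mean :: "'a measure \<Rightarrow> (nat \<Rightarrow> 'a \<Rightarrow> nat) \<Rightarrow> nat \<Rightarrow> real" where
  "stratum_mean M S n = (\<integral>\<omega>. real (S n \<omega>) \<partial>M)"

definition stratum_mean_gf :: "'a measure \<Rightarrow> (nat \<Rightarrow> 'a \<Rightarrow> nat) \<Rightarrow> real fps" where
  "stratum_mean_gf M S = Abs_fps (stratum_mean M S)"

definition stratum_zero_gf :: "'a measure \<Rightarrow> (nat \<Rightarrow> 'a \<Rightarrow> nat) \<Rightarrow> real fps" where
  "stratum_zero_gf M S = Abs_fps (\<lambda>n. \<P>(\<omega> in M. S n \<omega> = 0))"

end

theory Submission
  imports Defs "HOL-Real_Asymp.Real_Asymp"
begin

text \<open>
  Writing \<open>A f k = p f(k+1) + q f(k-1)\<close> with truncated subtraction, \<open>E f(S\<^sub>n) = (A\<^sup>n f)(0)\<close>, so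
  everything follows from the choice of suitable test functions \<open>f\<close>. From
  \<open>A id = id + (p - q) + q 1\<^bsub>{0}\<^esub>\<close> one obtains the recurrence for the means and hence the
  generating function.

  For \<open>p > 1/2\<close>, adding \<open>q (q/p)\<^sup>k / (p - q)\<close> to \<open>k\<close> removes the term \<open>q 1\<^bsub>{0}\<^esub>\<close>, and
  \<open>E (q/p)\<^bsup>S\<^esup>\<close> decays at rate \<open>2 sqrt(pq)\<close> because \<open>h(k) = (q/p)\<^bsup>k/2\<^esup>\<close> satisfies
  \<open>A h \<le> 2 sqrt(pq) h\<close>. For \<open>p < 1/2\<close>, the tails \<open>P(S\<^sub>n \<ge> k)\<close> obey the dual recurrence with
  absorption at \<open>0\<close>; their distance to the stationary tails \<open>(p/q)\<^sup>k\<close> lies between \<open>0\<close> and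
  \<open>(2 sqrt(pq))\<^sup>n (p/q)\<^bsup>k/2\<^esup>\<close>, and summing over \<open>k \<ge> 1\<close> gives the mean. For \<open>p = 1/2\<close>,
  \<open>P(S\<^sub>n = k) = C(n, \<lfloor>(n+k+1)/2\<rfloor>) / 2\<^sup>n\<close>, so the mean is an explicit multiple of a
  central binomial coefficient, to which Wallis' product applies.
\<close>

section \<open>From the law of the chain to an averaging operator\<close>

text \<open>At \<open>k = 0\<close> truncated subtraction gives \<open>k - 1 = 0\<close>, so the
  rule for the single-node tree is built in without a case distinction.\<close>

definition walk_step :: "real \<Rightarrow> (nat \<Rightarrow> real) \<Rightarrow> nat \<Rightarrow> real" where
  "walk_step p f k = p * f (k + 1) + (1 - p) * f (k - 1)"

lemma stratum_transition_altdef: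
  "stratum_transition p k j = (if j = k + 1 then p else 0) + (if j = k - 1 then 1 - p else 0)"
  unfolding stratum_transition_def by (cases k) auto

lemma sum_stratum_transition:
  assumes "k \<le> n"
  shows "(\<Sum>j\<le>Suc n. f j * stratum_transition p k j) = walk_step p f k"
proof -
  have "(\<Sum>j\<le>Suc n. f j * stratum_transition p k j) =
      (\<Sum>j\<le>Suc n. if j = k + 1 then p * f j else 0)
        + (\<Sum>j\<le>Suc n. if j = k - 1 then (1 - p) * f j else 0)"
    unfolding sum.distrib[symmetric] stratum_transition_altdef by (intro sum.cong) auto
  also have "\<dots> = walk_step p f k"
    using assms by (subst (1 2) sum.delta) (auto simp: walk_step_def)
  finally show ?thesis .
qed

text \<open>The Markov property conditions on whole histories. The event that \<open>S n\<close>
  equals \<open>k\<close> is therefore split into all histories ending in \<open>k\<close>; they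
  share one transition probability, which factors out of the sum.\<close>

lemma stratum_chain_joint:
  assumes "stratum_chain M p S" and p: "0 \<le> p" "p \<le> 1"
  shows "\<P>(\<omega> in M. S (Suc n) \<omega> = j \<and> S n \<omega> = k)
    = stratum_transition p k j * \<P>(\<omega> in M. S n \<omega> = k)"
proof -
  interpret prob_space M using assms by (simp add: stratum_chain_def)
  have [measurable]: "S i \<in> measurable M (count_space UNIV)" for i
    using assms by (simp add: stratum_chain_def)
  have T: "0 \<le> stratum_transition p k j"
    using p by (simp add: stratum_transition_def)
  \<comment> \<open>Histories are encoded as lists because these form a countable type, unlike
    functions on \<open>nat\<close>; countable additivity then applies.\<close>
  define L where "L = {l :: nat list. length l = Suc n \<and> l ! n = k}"
  define H where "H l = {\<omega> \<in> space M. \<forall>i\<le>n. S i \<omega> = l ! i}" for l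
  have L: "countable L" by simp
  have [measurable]: "H l \<in> sets M" for l unfolding H_def by measurable
  have disj: "disjoint_family_on H L"
    unfolding disjoint_family_on_def
  proof (intro ballI impI)
    fix l m assume lm: "l \<in> L" "m \<in> L" "l \<noteq> m"
    then obtain i where "i < Suc n" "l ! i \<noteq> m ! i"
      unfolding L_def by (auto simp: list_eq_iff_nth_eq)
    then have "i \<le> n" "l ! i \<noteq> m ! i" by auto
    then show "H l \<inter> H m = {}" unfolding H_def by auto
  qed
  have cover: "{\<omega> \<in> space M. S n \<omega> = k} = (\<Union>l\<in>L. H l)"
  proof (intro equalityI subsetI)
    fix \<omega> assume "\<omega> \<in> {\<omega> \<in> space M. S n \<omega> = k}"
    then have "\<omega> \<in> H (map (\<lambda>i. S i \<omega>) [0..<Suc n])" "map (\<lambda>i. S i \<omega>) [0..<Suc n] \<in> L"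
      by (auto simp: H_def L_def nth_append less_Suc_eq_le simp del: upt_Suc)
    then show "\<omega> \<in> (\<Union>l\<in>L. H l)" by blast
  qed (auto simp: H_def L_def)
  define J where "J l = {\<omega> \<in> space M. S (Suc n) \<omega> = j} \<inter> H l" for l
  have "{\<omega> \<in> space M. S (Suc n) \<omega> = j \<and> S n \<omega> = k} = {\<omega> \<in> space M. S (Suc n) \<omega> = j} \<inter> (\<Union>l\<in>L. H l)"
    unfolding cover[symmetric] by auto
  also have "\<dots> = (\<Union>l\<in>L. J l)" unfolding J_def by auto
  finally have cover': "{\<omega> \<in> space M. S (Suc n) \<omega> = j \<and> S n \<omega> = k} = (\<Union>l\<in>L. J l)" .
  have step: "emeasure M (J l) = ennreal (stratum_transition p k j) * emeasure M (H l)"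
    if "l \<in> L" for l
  proof -
    have "measure M (J l) = stratum_transition p k j * measure M (H l)"
    \<comment> \<open>The Markov property says nothing about a history of probability 0, but there
      both sides vanish.\<close>
    proof (cases "measure M (H l) = 0")
      case True
      have "measure M (J l) \<le> measure M (H l)"
        by (intro finite_measure_mono) (auto simp: J_def)
      with True show ?thesis by (simp add: measure_le_0_iff)
    next
      case False
      then have pos: "\<P>(\<omega> in M. \<forall>i\<le>n. S i \<omega> = l ! i) > 0"
        unfolding H_def by (simp add: zero_less_measure_iff)
      with assms(1) have "\<P>(\<omega> in M. S (Suc n) \<omega> = j \<bar> \<forall>i\<le>n. S i \<omega> = l ! i)
          = stratum_transition p (l ! n) j"
        unfolding stratum_chain_def by blast
      moreover have "{\<omega> \<in> space M. S (Suc n) \<omega> = j \<and> (\<forall>i\<le>n. S i \<omega> = l ! i)} = J l"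
        by (auto simp: J_def H_def)
      ultimately show ?thesis
        using pos that unfolding cond_prob_def H_def L_def by (auto simp: field_simps)
    qed
    then show ?thesis using T by (simp add: emeasure_eq_measure ennreal_mult)
  qed
  have "emeasure M {\<omega> \<in> space M. S (Suc n) \<omega> = j \<and> S n \<omega> = k}
      = (\<integral>\<^sup>+l. emeasure M (J l) \<partial>count_space L)"
    unfolding cover'
  proof (rule emeasure_UN_countable)
    show "disjoint_family_on J L"
      using disj unfolding disjoint_family_on_def J_def by blast
  qed (use L in \<open>auto simp: J_def\<close>)
  also have "\<dots> = (\<integral>\<^sup>+l. ennreal (stratum_transition p k j) * emeasure M (H l) \<partial>count_space L)"
    by (intro nn_integral_cong) (simp add: step)
  also have "\<dots> = ennreal (stratum_transition p k j) * emeasure M {\<omega> \<in> space M. S n \<omega> = k}"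
    unfolding cover by (subst emeasure_UN_countable[OF _ L disj]) (simp_all add: nn_integral_cmult)
  finally show ?thesis
    using T by (simp add: emeasure_eq_measure ennreal_mult[symmetric])
qed

lemma stratum_chain_prob_Suc:
  assumes "stratum_chain M p S" and p: "0 \<le> p" "p \<le> 1"
  shows "(\<lambda>k. stratum_transition p k j * \<P>(\<omega> in M. S n \<omega> = k)) sums \<P>(\<omega> in M. S (Suc n) \<omega> = j)"
proof -
  interpret prob_space M using assms by (simp add: stratum_chain_def)
  have [measurable]: "S i \<in> measurable M (count_space UNIV)" for i
    using assms by (simp add: stratum_chain_def)
  define B where "B k = {\<omega> \<in> space M. S (Suc n) \<omega> = j \<and> S n \<omega> = k}" for k
  have "(\<lambda>k. measure M (B k)) sums measure M (\<Union>k. B k)"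
    by (rule finite_measure_UNION) (auto simp: B_def disjoint_family_on_def)
  moreover have "(\<Union>k. B k) = {\<omega> \<in> space M. S (Suc n) \<omega> = j}"
    by (auto simp: B_def)
  ultimately show ?thesis
    using stratum_chain_joint[OF assms] by (simp add: B_def)
qed

text \<open>The chain starts at \<open>0\<close> and climbs at most one level per step. Expectations
  of arbitrary test functions thereby reduce to finite sums.\<close>

lemma stratum_chain_prob_eq_0:
  assumes "stratum_chain M p S" and p: "0 \<le> p" "p \<le> 1" and "n < k"
  shows "\<P>(\<omega> in M. S n \<omega> = k) = 0"
  using \<open>n < k\<close>
proof (induction n arbitrary: k)
  case 0
  have "AE \<omega> in M. \<not> S 0 \<omega> = k"
    using assms(1) 0 unfolding stratum_chain_def by auto
  then show ?case by (simp add: measure_eq_AE AE_iff_measurable measure_def AE_E2 emeasure_eq_0_AE)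
next
  case (Suc n)
  have "(\<lambda>i. stratum_transition p i k * \<P>(\<omega> in M. S n \<omega> = i)) = (\<lambda>_. 0)"
  proof
    fix i
    show "stratum_transition p i k * \<P>(\<omega> in M. S n \<omega> = i) = 0"
    proof (cases "n < i")
      case False
      then have "stratum_transition p i k = 0"
        using Suc.prems by (simp add: stratum_transition_altdef)
      then show ?thesis by simp
    qed (simp add: Suc.IH)
  qed
  then have "(\<lambda>i. 0) sums \<P>(\<omega> in M. S (Suc n) \<omega> = k)"
    using stratum_chain_prob_Suc[OF assms(1-3), of k n] by (simp only:)
  then show ?case by (rule sums_unique2) (rule sums_zero)
qed

lemma stratum_chain_AE_le:
  assumes "stratum_chain M p S" and p: "0 \<le> p" "p \<le> 1"
  shows "AE \<omega> in M. S n \<omega> \<le> n"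
proof -
  interpret prob_space M using assms by (simp add: stratum_chain_def)
  have [measurable]: "S i \<in> measurable M (count_space UNIV)" for i
    using assms by (simp add: stratum_chain_def)
  have "AE \<omega> in M. \<forall>k. n < k \<longrightarrow> S n \<omega> \<noteq> k"
    unfolding AE_all_countable
  proof
    fix k
    show "AE \<omega> in M. n < k \<longrightarrow> S n \<omega> \<noteq> k"
    proof (cases "n < k")
      case True
      have "{\<omega> \<in> space M. S n \<omega> = k} \<in> null_sets M"
        using stratum_chain_prob_eq_0[OF assms True]
        by (intro null_setsI) (auto simp: emeasure_eq_measure)
      from AE_not_in[OF this] show ?thesis by (rule AE_mp) (intro AE_I2, auto)
    qed simp
  qed
  then show ?thesis by (rule AE_mp) (intro AE_I2, use not_le in blast)
qed

lemma stratum_chain_expectation_sum: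
  fixes f :: "nat \<Rightarrow> real"
  assumes "stratum_chain M p S" and p: "0 \<le> p" "p \<le> 1"
  shows "(\<integral>\<omega>. f (S n \<omega>) \<partial>M) = (\<Sum>k\<le>n. f k * \<P>(\<omega> in M. S n \<omega> = k))"
proof -
  interpret prob_space M using assms by (simp add: stratum_chain_def)
  have [measurable]: "S i \<in> measurable M (count_space UNIV)" for i
    using assms by (simp add: stratum_chain_def)
  have "AE \<omega> in M. f (S n \<omega>) = (\<Sum>k\<le>n. f k * indicator {\<omega> \<in> space M. S n \<omega> = k} \<omega>)"
    using stratum_chain_AE_le[OF assms, of n] AE_space
  proof eventually_elim
    case (elim \<omega>)
    have "(\<Sum>k\<le>n. f k * indicator {\<omega> \<in> space M. S n \<omega> = k} \<omega>) = (\<Sum>k\<le>n. if k = S n \<omega> then f k else 0)"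
      using elim by (intro sum.cong) (auto simp: indicator_def)
    then show ?case using elim by simp
  qed
  then have "(\<integral>\<omega>. f (S n \<omega>) \<partial>M)
      = (\<integral>\<omega>. (\<Sum>k\<le>n. f k * indicator {\<omega> \<in> space M. S n \<omega> = k} \<omega>) \<partial>M)"
    by (intro integral_cong_AE) auto
  also have "\<dots> = (\<Sum>k\<le>n. f k * \<P>(\<omega> in M. S n \<omega> = k))"
    by (subst Bochner_Integration.integral_sum) (auto simp: emeasure_eq_measure)
  finally show ?thesis .
qed

text \<open>Exchanging two finite sums moves the transition from the law of the chain onto the test
  function.\<close>

lemma stratum_chain_expectation_Suc:
  assumes "stratum_chain M p S" and p: "0 \<le> p" "p \<le> 1"
  shows "(\<integral>\<omega>. f (S (Suc n) \<omega>) \<partial>M) = (\<integral>\<omega>. walk_step p f (S n \<omega>) \<partial>M)"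
proof -
  let ?P = "\<lambda>n k. \<P>(\<omega> in M. S n \<omega> = k)"
  have P: "?P (Suc n) j = (\<Sum>k\<le>n. stratum_transition p k j * ?P n k)" for j
  proof -
    have "(\<lambda>k. stratum_transition p k j * ?P n k) sums (\<Sum>k\<le>n. stratum_transition p k j * ?P n k)"
      using stratum_chain_prob_eq_0[OF assms] by (intro sums_finite) auto
    with stratum_chain_prob_Suc[OF assms, of j n] show ?thesis by (rule sums_unique2)
  qed
  have "(\<integral>\<omega>. f (S (Suc n) \<omega>) \<partial>M)
      = (\<Sum>j\<le>Suc n. \<Sum>k\<le>n. f j * stratum_transition p k j * ?P n k)"
    unfolding stratum_chain_expectation_sum[OF assms] P by (simp add: sum_distrib_left mult.assoc)
  also have "\<dots> = (\<Sum>k\<le>n. (\<Sum>j\<le>Suc n. f j * stratum_transition p k j) * ?P n k)"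
    by (subst sum.swap) (simp only: sum_distrib_right)
  also have "\<dots> = (\<Sum>k\<le>n. walk_step p f k * ?P n k)"
    by (intro sum.cong refl) (simp only: sum_stratum_transition atMost_iff)
  also have "\<dots> = (\<integral>\<omega>. walk_step p f (S n \<omega>) \<partial>M)"
    by (rule stratum_chain_expectation_sum[OF assms, symmetric])
  finally show ?thesis .
qed

text \<open>The test function must be arbitrary in the induction, since each step replaces
  \<open>f\<close> by \<open>walk_step p f\<close>. This identity reduces the analysis to iterates
  of \<open>walk_step\<close>.\<close>

lemma stratum_chain_expectation:
  assumes "stratum_chain M p S" and "0 \<le> p" "p \<le> 1"
  shows "(\<integral>\<omega>. f (S n \<omega>) \<partial>M) = (walk_step p ^^ n) f 0"
proof (induction n arbitrary: f)
  case 0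
  interpret prob_space M using assms by (simp add: stratum_chain_def)
  have [measurable]: "S i \<in> measurable M (count_space UNIV)" for i
    using assms by (simp add: stratum_chain_def)
  have "AE \<omega> in M. S 0 \<omega> = 0" using assms(1) by (simp add: stratum_chain_def)
  then have "(\<integral>\<omega>. f (S 0 \<omega>) \<partial>M) = (\<integral>\<omega>. f 0 \<partial>M)"
    by (intro integral_cong_AE) auto
  then show ?case by (simp add: prob_space)
next
  case (Suc n)
  then show ?case
    by (simp add: stratum_chain_expectation_Suc[OF assms] funpow_swap1)
qed

section \<open>Algebra of the iterated operator\<close>

lemma funpow_walk_step_linear:
  "(walk_step p ^^ n) (\<lambda>k. a * f k + b * g k) =
    (\<lambda>k. a * (walk_step p ^^ n) f k + b * (walk_step p ^^ n) g k)"
  by (induction n) (simp_all add: walk_step_def[abs_def] algebra_simps)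

lemma funpow_walk_step_const: "(walk_step p ^^ n) (\<lambda>_. c) = (\<lambda>_. c)"
  by (induction n) (simp_all add: walk_step_def[abs_def] algebra_simps)

lemma funpow_walk_step_mono:
  assumes "0 \<le> p" "p \<le> 1" "\<And>k. f k \<le> g k"
  shows "(walk_step p ^^ n) f k \<le> (walk_step p ^^ n) g k"
proof (induction n arbitrary: k)
  case (Suc n)
  then show ?case using assms by (simp add: walk_step_def add_mono mult_left_mono)
qed (use assms in simp)

text \<open>In \<open>n\<close> steps from \<open>k\<close> the walk cannot pass
  \<open>k + n\<close>. This allows infinite tail sums to be truncated.\<close>

lemma funpow_walk_step_cong:
  assumes "\<And>i. i \<le> k + n \<Longrightarrow> f i = g i"
  shows "(walk_step p ^^ n) f k = (walk_step p ^^ n) g k"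
  using assms
proof (induction n arbitrary: k)
  case (Suc n)
  have "(walk_step p ^^ n) f (k + 1) = (walk_step p ^^ n) g (k + 1)"
    using Suc.prems by (intro Suc.IH) auto
  moreover have "(walk_step p ^^ n) f (k - 1) = (walk_step p ^^ n) g (k - 1)"
    using Suc.prems by (intro Suc.IH) auto
  ultimately have "walk_step p ((walk_step p ^^ n) f) k = walk_step p ((walk_step p ^^ n) g) k"
    unfolding walk_step_def by metis
  then show ?case by simp
qed simp

lemma funpow_walk_step_sum:
  "(walk_step p ^^ n) (\<lambda>k. \<Sum>i\<in>I. f i k) = (\<lambda>k. \<Sum>i\<in>I. (walk_step p ^^ n) (f i) k)"
  by (induction n) (simp_all add: walk_step_def[abs_def] sum.distrib sum_distrib_left)

text \<open>Away from \<open>0\<close> the mean increment is \<open>2 * p - 1\<close>; at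
  \<open>0\<close> the suppressed deletion adds \<open>1 - p\<close>.\<close>

lemma walk_step_real_eq:
  "walk_step p real = (\<lambda>k. real k + (2 * p - 1) + (1 - p) * of_bool (k = 0))"
proof
  show "walk_step p real k = real k + (2 * p - 1) + (1 - p) * of_bool (k = 0)" for k
    by (cases k) (simp_all add: walk_step_def algebra_simps)
qed

lemma funpow_walk_step_real_Suc:
  "(walk_step p ^^ Suc n) real 0 =
    (walk_step p ^^ n) real 0 + (2 * p - 1) + (1 - p) * (walk_step p ^^ n) (\<lambda>k. of_bool (k = 0)) 0"
proof -
  \<comment> \<open>The redundant factors \<open>1\<close> give both nested sums the shape that
    \<open>funpow_walk_step_linear\<close> rewrites.\<close>
  have "walk_step p real = (\<lambda>k. 1 * (1 * real k + (2 * p - 1) * 1) + (1 - p) * of_bool (k = 0))"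
    by (simp add: walk_step_real_eq)
  then have "(walk_step p ^^ Suc n) real =
      (walk_step p ^^ n) (\<lambda>k. 1 * (1 * real k + (2 * p - 1) * 1) + (1 - p) * of_bool (k = 0))"
    by (simp only: funpow_Suc_right o_def)
  then show ?thesis
    by (simp only: funpow_walk_step_linear funpow_walk_step_const) (simp only: mult_1 mult_1_right)
qed

lemma funpow_walk_step_nonneg:
  assumes "0 \<le> p" "p \<le> 1" "\<And>k. 0 \<le> f k"
  shows "0 \<le> (walk_step p ^^ n) f k"
  using funpow_walk_step_mono[OF assms(1,2), of "\<lambda>_. 0" f n k] assms(3)
  by (simp add: funpow_walk_step_const)

section \<open>Upward drift, \<open>1 / 2 < p\<close>\<close>

text \<open>The choice of \<open>r\<close> makes the upward and the downward contribution
  equal.\<close>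

lemma walk_step_power_Suc:
  assumes "p * r\<^sup>2 = 1 - p"
  shows "walk_step p (\<lambda>k. r ^ k) (Suc k) = 2 * p * r * r ^ Suc k"
proof -
  have "walk_step p (\<lambda>k. r ^ k) (Suc k) = p * r ^ (k + 2) + (1 - p) * r ^ k"
    by (simp add: walk_step_def)
  also have "\<dots> = 2 * p * r * r ^ Suc k"
    unfolding assms[symmetric] by (simp add: power2_eq_square algebra_simps)
  finally show ?thesis .
qed

text \<open>This \<open>r\<close> minimises \<open>p * r + (1 - p) / r\<close>, the growth factor of
  \<open>r ^ k\<close> away from \<open>0\<close>; the minimum is
  \<open>2 * sqrt (p * (1 - p))\<close>. Monotonicity of the operator then iterates the one-step
  bound.\<close>

lemma funpow_walk_step_superharmonic:
  assumes p: "1 / 2 < p" "p < 1" and r: "r = sqrt ((1 - p) / p)"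
  shows "(walk_step p ^^ n) (\<lambda>k. r ^ k) 0 \<le> (2 * sqrt (p * (1 - p))) ^ n"
proof -
  have r2: "r\<^sup>2 = (1 - p) / p" and r0: "0 < r" using p by (auto simp: r)
  have pr: "p * r = sqrt (p * (1 - p))"
  proof -
    have "p * r = sqrt (p\<^sup>2) * r" using p by simp
    also have "\<dots> = sqrt (p * (1 - p))"
      unfolding r real_sqrt_mult[symmetric] using p by (simp add: power2_eq_square)
    finally show ?thesis .
  qed
  have r1: "r \<le> 1" using p by (simp add: r)
  have q: "1 - p = p * r * r" using r2 p by (simp add: power2_eq_square field_simps)
  have step: "walk_step p (\<lambda>k. r ^ k) k \<le> (2 * p * r) * r ^ k" for k
  proof (cases k)
    \<comment> \<open>At the boundary the claim is \<open>p * r + (1 - p) \<le> 2 * p * r\<close>,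
      which reduces to \<open>r \<le> 1\<close>.\<close>
    case 0
    have "p * r * r \<le> p * r" using r1 r0 p by (simp add: mult_left_le)
    then show ?thesis using 0 q by (simp add: walk_step_def)
  next
    case (Suc j)
    then show ?thesis using walk_step_power_Suc[of p r j] q by (simp add: power2_eq_square)
  qed
  have "(walk_step p ^^ n) (\<lambda>k. r ^ k) k \<le> (2 * p * r) ^ n * r ^ k" for k
  proof (induction n arbitrary: k)
    case (Suc n)
    have "(walk_step p ^^ Suc n) (\<lambda>k. r ^ k) k = (walk_step p ^^ n) (walk_step p (\<lambda>k. r ^ k)) k"
      by (simp add: funpow_swap1)
    also have "\<dots> \<le> (walk_step p ^^ n) (\<lambda>k. (2 * p * r) * r ^ k + 0 * r ^ k) k"
      using p step by (intro funpow_walk_step_mono) auto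
    also have "\<dots> = (2 * p * r) * (walk_step p ^^ n) (\<lambda>k. r ^ k) k"
      by (subst funpow_walk_step_linear) simp
    also have "\<dots> \<le> (2 * p * r) * ((2 * p * r) ^ n * r ^ k)"
      using Suc p r0 by (intro mult_left_mono) auto
    finally show ?case by (simp add: mult_ac)
  qed simp
  from this[of 0] show ?thesis using pr by (simp add: mult.assoc)
qed

text \<open>The corrected function \<open>real k + c * g k\<close> grows by exactly
  \<open>p - q\<close> per step, so the error is \<open>c\<close> times the expectation of
  \<open>g\<close>, which lies between \<open>0\<close> and the superharmonic bound.\<close>

lemma walk_mean_drift_pos:
  assumes p: "1 / 2 < p" "p < 1"
  defines "q \<equiv> 1 - p"
  shows "\<bar>(walk_step p ^^ n) real 0 - ((p - q) * real n + q / (p - q))\<bar>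
    \<le> q / (p - q) * (2 * sqrt (p * q)) ^ n"
proof -
  define r where "r = sqrt ((1 - p) / p)"
  \<comment> \<open>At \<open>0\<close> the operator lowers \<open>g\<close> by
    \<open>p - q\<close>; this \<open>c\<close> makes the loss cancel the boundary excess
    \<open>q\<close>.\<close>
  define c where "c = q / (p - q)"
  define g where "g = (\<lambda>k. (q / p) ^ k)"
  have c: "0 \<le> c" using p by (simp add: c_def q_def)
  have r2: "r\<^sup>2 = q / p" and r0: "0 \<le> r" and r1: "r \<le> 1" using p by (auto simp: r_def q_def)
  \<comment> \<open>the factors \<open>1\<close> let funpow_walk_step_linear match syntactically\<close>
  have step: "walk_step p (\<lambda>k. 1 * real k + c * g k) k
    = 1 * (1 * real k + c * g k) + (p - q) * 1" for k
  proof (cases k)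
    case 0
    have "p + c * (p * (q / p) + q) = c + (p - q)"
      using p unfolding c_def q_def by (simp add: field_simps)
    then show ?thesis using 0 by (simp add: walk_step_def g_def q_def algebra_simps)
  next
    case (Suc j)
    have "p * (q / p) ^ Suc (Suc j) + q * (q / p) ^ j = (q / p) ^ Suc j"
      using p by (simp add: q_def field_simps)
    moreover have "p * (1 * real (k + 1) + c * g (k + 1)) + q * (1 * real (k - 1) + c * g (k - 1))
       = real k + (p - q) + c * (p * (q / p) ^ Suc (Suc j) + q * (q / p) ^ j)"
      unfolding Suc g_def by (simp add: q_def algebra_simps)
    ultimately show ?thesis by (simp add: walk_step_def g_def q_def Suc)
  qed
  have "(walk_step p ^^ n) (\<lambda>k. 1 * real k + c * g k) 0 = (p - q) * real n + c"
  proof (induction n)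
    case (Suc n)
    have "(walk_step p ^^ Suc n) (\<lambda>k. 1 * real k + c * g k) 0
      = (walk_step p ^^ n) (\<lambda>k. 1 * (1 * real k + c * g k) + (p - q) * 1) 0"
      unfolding funpow_Suc_right o_apply by (simp only: step[abs_def])
    also have "\<dots> = 1 * (walk_step p ^^ n) (\<lambda>k. 1 * real k + c * g k) 0 + (p - q) * 1"
      by (simp only: funpow_walk_step_linear[of n p 1 "\<lambda>k. 1 * real k
          + c * g k"] funpow_walk_step_const)
    finally show ?case using Suc by (simp add: algebra_simps)
  qed (simp add: g_def)
  then have "1 * (walk_step p ^^ n) real 0 + c * (walk_step p ^^ n) g 0 = (p - q) * real n + c"
    by (simp only: funpow_walk_step_linear)
  then have eq: "(walk_step p ^^ n) real 0 + c * (walk_step p ^^ n) g 0 = (p - q) * real n + c"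
    by simp
  have "(walk_step p ^^ n) g 0 \<le> (walk_step p ^^ n) (\<lambda>k. r ^ k) 0"
  proof (rule funpow_walk_step_mono)
    fix k
    have "g k = (r ^ k)\<^sup>2" unfolding g_def r2[symmetric]
        by (simp add: power_mult[symmetric] mult.commute)
    then show "g k \<le> r ^ k" using r0 r1 by (simp add: power2_eq_square mult_left_le power_le_one)
  qed (use p in auto)
  also have "\<dots> \<le> (2 * sqrt (p * q)) ^ n"
    unfolding q_def by (rule funpow_walk_step_superharmonic) (use p r_def in auto)
  finally have "c * (walk_step p ^^ n) g 0 \<le> c * (2 * sqrt (p * q)) ^ n"
    using c by (rule mult_left_mono)
  moreover have "0 \<le> c * (walk_step p ^^ n) g 0"
    using c p by (intro mult_nonneg_nonneg funpow_walk_step_nonneg) (auto simp: g_def q_def)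
  ultimately show ?thesis using eq unfolding c_def[symmetric] by linarith
qed

section \<open>Downward drift, \<open>p < 1 / 2\<close>\<close>

text \<open>Duality: as a function of the level, the tail is the probability that a walk with
  up-probability \<open>1 - p\<close> and down-probability \<open>p\<close> has been absorbed at
  \<open>0\<close> by time \<open>n\<close>.\<close>

lemma funpow_walk_step_tail_Suc:
  "(walk_step p ^^ Suc n) (\<lambda>k. of_bool (Suc j \<le> k)) 0 =
    p * (walk_step p ^^ n) (\<lambda>k. of_bool (j \<le> k)) 0 +
    (1 - p) * (walk_step p ^^ n) (\<lambda>k. of_bool (Suc (Suc j) \<le> k)) 0"
proof -
  have "walk_step p (\<lambda>k. of_bool (Suc j \<le> k)) =
      (\<lambda>k. p * of_bool (j \<le> k) + (1 - p) * of_bool (Suc (Suc j) \<le> k))"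
    by (rule ext) (auto simp: walk_step_def)
  then show ?thesis
    by (simp only: funpow_Suc_right o_apply funpow_walk_step_linear)
qed

text \<open>The gap to \<open>(p / q) ^ j\<close> obeys the tail recurrence with value
  \<open>0\<close> at \<open>j = 0\<close>, so it stays nonnegative. It is dominated by
  \<open>(2 * q * r) ^ n * r ^ j\<close>, which solves the recurrence for \<open>j > 0\<close>
  because \<open>p = q * r * r\<close>.\<close>

lemma funpow_walk_step_tail:
  assumes p: "0 < p" "p < 1 / 2"
  defines "q \<equiv> 1 - p"
  defines "u \<equiv> \<lambda>n j. (walk_step p ^^ n) (\<lambda>k. of_bool (j \<le> k)) 0"
  shows "0 \<le> (p / q) ^ j - u n j" "(p / q) ^ j - u n j \<le> (2 * sqrt (p * q)) ^ n * sqrt (p / q) ^ j"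
proof -
  define r where "r = sqrt (p / q)"
  have r2: "r\<^sup>2 = p / q" and r0: "0 < r" and r1: "r \<le> 1" and q: "0 < q"
      using p by (auto simp: r_def q_def)
  have qr: "sqrt (p * q) = q * r"
  proof -
    have "q * r = sqrt (q\<^sup>2) * r" using q by simp
    also have "\<dots> = sqrt (p * q)"
      unfolding r_def real_sqrt_mult[symmetric] using q by (simp add: power2_eq_square)
    finally show ?thesis by simp
  qed
  have pq: "p = q * r * r" using r2 q by (simp add: power2_eq_square field_simps)
  have u0: "u n 0 = 1" for n by (simp add: u_def funpow_walk_step_const)
  have uS: "u (Suc n) (Suc j) = p * u n j + q * u n (Suc (Suc j))" for n j
    unfolding u_def q_def by (rule funpow_walk_step_tail_Suc)
  have "0 \<le> (p / q) ^ j - u n j \<and> (p / q) ^ j - u n j \<le> (2 * (q * r)) ^ n * r ^ j"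
  proof (induction n arbitrary: j)
    case 0
    show ?case
    proof (cases j)
      case (Suc i)
      have "(p / q) ^ j = r ^ j * r ^ j" unfolding r2[symmetric]
          by (simp add: power2_eq_square power_mult_distrib)
      moreover have "r ^ j * r ^ j \<le> r ^ j" using r0 r1 by (simp add: mult_left_le power_le_one)
      ultimately show ?thesis using Suc p q by (simp add: u_def)
    qed (simp add: u_def)
  next
    case (Suc n)
    show ?case
    proof (cases j)
      case 0
      then show ?thesis using u0 q r0 by simp
    next
      case (Suc i)
      have h: "(p / q) ^ j = p * (p / q) ^ i + q * (p / q) ^ Suc (Suc i)"
      proof -
        \<comment> \<open>This root makes the powers of \<open>p / q\<close> invariant under the
          tail recurrence.\<close>
        have x: "p / q = p + q * (p / q) * (p / q)"
          using q by (simp add: field_simps) (simp add: q_def algebra_simps)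
        have "(p / q) ^ j = (p / q) * (p / q) ^ i" using Suc by simp
        also have "\<dots> = (p + q * (p / q) * (p / q)) * (p / q) ^ i" by (simp only: x[symmetric])
        finally show ?thesis by (simp only: power_Suc distrib_right mult.assoc)
      qed
      have d: "(p / q) ^ j - u (Suc n) j
          = p * ((p / q) ^ i - u n i) + q * ((p / q) ^ Suc (Suc i) - u n (Suc (Suc i)))"
        by (subst h) (simp only: Suc uS right_diff_distrib add_diff_add)
      also have "\<dots> \<le> p * ((2 * (q * r)) ^ n * r ^ i) + q * ((2 * (q * r)) ^ n * r ^ Suc (Suc i))"
        by (intro add_mono mult_left_mono Suc.IH[THEN conjunct2]) (use p q in auto)
      also have "\<dots> = (2 * (q * r)) ^ Suc n * r ^ j"
        unfolding Suc by (subst pq) (simp add: algebra_simps)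
      finally have "(p / q) ^ j - u (Suc n) j \<le> (2 * (q * r)) ^ Suc n * r ^ j" .
      moreover have "0 \<le> (p / q) ^ j - u (Suc n) j"
        unfolding d by (intro add_nonneg_nonneg mult_nonneg_nonneg Suc.IH[THEN conjunct1])
            (use p q in auto)
      ultimately show ?thesis by blast
    qed
  qed
  then show "0 \<le> (p / q) ^ j - u n j" "(p / q) ^ j - u n j
      \<le> (2 * sqrt (p * q)) ^ n * sqrt (p / q) ^ j"
    by (simp_all add: qr r_def)
qed

text \<open>The mean of a variable on \<open>nat\<close> is the sum of its tails. An infinite series
  is stated so that it can be subtracted from a geometric one.\<close>

lemma funpow_walk_step_real_tail_sum:
  "(\<lambda>j. (walk_step p ^^ n) (\<lambda>k. of_bool (Suc j \<le> k)) 0) sums (walk_step p ^^ n) real 0"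
proof -
  have "(\<lambda>j. (walk_step p ^^ n) (\<lambda>k. of_bool (Suc j \<le> k)) 0) sums
      (\<Sum>j<n. (walk_step p ^^ n) (\<lambda>k. of_bool (Suc j \<le> k)) 0)"
  proof (rule sums_finite)
    fix j assume "j \<notin> {..<n}"
    then have "(walk_step p ^^ n) (\<lambda>k. of_bool (Suc j \<le> k)) 0 = (walk_step p ^^ n) (\<lambda>_. 0) 0"
      by (intro funpow_walk_step_cong) auto
    then show "(walk_step p ^^ n) (\<lambda>k. of_bool (Suc j \<le> k)) 0 = 0"
      by (simp add: funpow_walk_step_const)
  qed simp
  also have "(\<Sum>j<n. (walk_step p ^^ n) (\<lambda>k. of_bool (Suc j \<le> k)) 0) =
      (walk_step p ^^ n) (\<lambda>k. \<Sum>j<n. of_bool (Suc j \<le> k)) 0"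
    by (simp only: funpow_walk_step_sum)
  also have "\<dots> = (walk_step p ^^ n) real 0"
  \<comment> \<open>The truncated sum agrees with \<open>real i\<close> only for
    \<open>i \<le> n\<close>, which is all that \<open>n\<close> steps from \<open>0\<close> can
    see.\<close>
  proof (rule funpow_walk_step_cong)
    fix i assume "i \<le> 0 + n"
    then have "{..<n} \<inter> {j. Suc j \<le> i} = {..<i}" by auto
    then show "(\<Sum>j<n. of_bool (Suc j \<le> i)) = real i" by (simp add: of_bool_def sum.If_cases)
  qed
  finally show ?thesis .
qed

text \<open>The tail estimates are summed over all positive levels; the stationary tails sum to
  \<open>p / (q - p)\<close>.\<close>

lemma walk_mean_drift_neg:
  assumes p: "0 < p" "p < 1 / 2"
  defines "q \<equiv> 1 - p"
  shows "\<bar>(walk_step p ^^ n) real 0 - p / (q - p)\<bar>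
    \<le> (\<Sum>j. sqrt (p / q) ^ Suc j) * (2 * sqrt (p * q)) ^ n"
proof -
  let ?d = "\<lambda>j. (p / q) ^ Suc j - (walk_step p ^^ n) (\<lambda>k. of_bool (Suc j \<le> k)) 0"
  let ?e = "\<lambda>j. (2 * sqrt (p * q)) ^ n * sqrt (p / q) ^ Suc j"
  have qp: "0 < q" "p < q" using p by (auto simp: q_def)
  have pq: "0 \<le> p / q" "p / q < 1" using p by (auto simp: q_def)
  have "(\<lambda>j. (p / q) * (p / q) ^ j) sums ((p / q) * (1 / (1 - p / q)))"
    using pq by (intro sums_mult geometric_sums) auto
  also have "(p / q) * (1 / (1 - p / q)) = p / (q - p)"
    using qp by (simp add: field_simps)
  finally have d: "?d sums (p / (q - p) - (walk_step p ^^ n) real 0)"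
    unfolding power_Suc by (intro sums_diff funpow_walk_step_real_tail_sum)
  have "summable (\<lambda>j. sqrt (p / q) ^ Suc j)"
    using pq by (subst summable_Suc_iff) (auto intro: summable_geometric)
  then have e: "?e sums ((2 * sqrt (p * q)) ^ n * (\<Sum>j. sqrt (p / q) ^ Suc j))"
    by (intro sums_mult summable_sums)
  have de: "0 \<le> ?d j" "?d j \<le> ?e j" for j
    unfolding q_def by (fact funpow_walk_step_tail[OF p])+
  have "0 \<le> p / (q - p) - (walk_step p ^^ n) real 0"
    using de(1) sums_zero d by (rule sums_le)
  moreover have "p / (q - p) - (walk_step p ^^ n) real 0
      \<le> (2 * sqrt (p * q)) ^ n * (\<Sum>j. sqrt (p / q) ^ Suc j)"
    using de(2) d e by (rule sums_le)
  ultimately show ?thesis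
      by (simp only: abs_minus_commute[of _ "p / (q - p)"] abs_of_nonneg mult.commute)
qed

section \<open>The symmetric case: exact law and mean\<close>

text \<open>The chain is the simple symmetric walk with \<open>k\<close> and \<open>-k - 1\<close>
  identified. Exactly one of the two has the parity of \<open>n\<close>, whence the single binomial
  coefficient. The induction is Pascal's rule.\<close>

lemma funpow_walk_step_half_indicator:
  "(walk_step (1 / 2) ^^ n) (\<lambda>i. of_bool (i = k)) 0 = real (n choose ((n + k + 1) div 2)) / 2 ^ n"
proof (induction n arbitrary: k)
  case 0
  then show ?case by (cases k) auto
next
  case (Suc n)
  show ?case
  proof (cases k)
    case 0
    have "walk_step (1 / 2) (\<lambda>i. of_bool (i = 0)) =
        (\<lambda>i. 1 / 2 * of_bool (i = 0) + 1 / 2 * of_bool (i = 1))"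
      by (rule ext) (auto simp: walk_step_def)
    then have "(walk_step (1 / 2) ^^ Suc n) (\<lambda>i. of_bool (i = 0)) 0 =
        1 / 2 * (real (n choose ((n + 0 + 1) div 2)) / 2 ^ n)
            + 1 / 2 * (real (n choose ((n + 1 + 1) div 2)) / 2 ^ n)"
      by (simp only: funpow_Suc_right o_apply funpow_walk_step_linear Suc)
    \<comment> \<open>At the boundary the two indices do not differ by one when \<open>n\<close> is
      odd; symmetry of the binomial coefficient restores the pair needed for Pascal's rule.\<close>
    moreover have "n choose ((n + 1) div 2) = n choose (n div 2)"
      by (subst binomial_symmetric) (auto intro!: arg_cong2[where f = binomial])
    ultimately show ?thesis using 0 by (simp add: field_simps)
  next
    case (Suc j)
    have "walk_step (1 / 2) (\<lambda>i. of_bool (i = k)) =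
        (\<lambda>i. 1 / 2 * of_bool (i = j) + 1 / 2 * of_bool (i = Suc (Suc j)))"
      by (rule ext) (auto simp: walk_step_def Suc)
    then have "(walk_step (1 / 2) ^^ Suc n) (\<lambda>i. of_bool (i = k)) 0 =
        1 / 2 * (real (n choose ((n + j + 1) div 2)) / 2 ^ n)
            + 1 / 2 * (real (n choose ((n + Suc (Suc j) + 1) div 2)) / 2 ^ n)"
      by (simp only: funpow_Suc_right o_apply funpow_walk_step_linear Suc.IH)
    then show ?thesis using Suc by (simp add: field_simps)
  qed
qed

text \<open>This is the probability that a simple symmetric walk is back at its start after
  \<open>2 * m\<close> steps.\<close>

definition central_ratio :: "nat \<Rightarrow> real" where
  "central_ratio m = real (2 * m choose m) / 4 ^ m"

text \<open>The absorption identity is applied twice, with binomial symmetry in between.\<close>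

lemma central_ratio_Suc: "2 * real (Suc m) * central_ratio (Suc m)
    = (2 * real m + 1) * central_ratio m"
proof -
  have "Suc m * (2 * Suc m choose Suc m) = 2 * Suc m * (Suc (2 * m) choose m)"
    using Suc_times_binomial[of m "Suc (2 * m)"] by simp
  moreover have "Suc (2 * m) choose m = Suc (2 * m) choose Suc m"
    by (subst binomial_symmetric) auto
  moreover have "Suc m * (Suc (2 * m) choose Suc m) = Suc (2 * m) * (2 * m choose m)"
    by (rule Suc_times_binomial)
  ultimately have "Suc m * (2 * Suc m choose Suc m) = 2 * (Suc (2 * m) * (2 * m choose m))"
    by (metis mult.assoc)
  then have "real (Suc m) * real (2 * Suc m choose Suc m)
      = 2 * (real (Suc (2 * m)) * real (2 * m choose m))"
    by (metis of_nat_mult of_nat_numeral)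
  moreover have "real (Suc (2 * m)) = 2 * real m + 1" by simp
  ultimately have "real (Suc m) * real (2 * Suc m choose Suc m)
      = 2 * ((2 * real m + 1) * real (2 * m choose m))"
    by (simp only:)
  then have AB: "2 * real (Suc m) * real (2 * Suc m choose Suc m)
      = 4 * ((2 * real m + 1) * real (2 * m choose m))"
    by (simp only: mult.assoc)
  have "2 * real (Suc m) * central_ratio (Suc m)
      = 2 * real (Suc m) * real (2 * Suc m choose Suc m) / 4 ^ Suc m"
    by (simp only: central_ratio_def times_divide_eq_right)
  also have "\<dots> = (2 * real m + 1) * central_ratio m"
    unfolding AB by (simp add: central_ratio_def)
  finally show ?thesis .
qed

lemma central_ratio_pos: "0 < central_ratio m"
  by (simp add: central_ratio_def)

lemma central_ratio_odd:
  "real (Suc (2 * m) choose Suc m) / 2 ^ Suc (2 * m) = central_ratio (Suc m)"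
proof -
  have "2 * Suc m choose Suc m = (Suc (2 * m) choose m) + (Suc (2 * m) choose Suc m)"
    by simp
  moreover have "Suc (2 * m) choose m = Suc (2 * m) choose Suc m"
    by (subst binomial_symmetric) auto
  ultimately have "real (2 * Suc m choose Suc m) = 2 * real (Suc (2 * m) choose Suc m)"
    by (metis of_nat_mult of_nat_numeral mult_2)
  moreover have "(2 :: real) ^ (2 * m) = 4 ^ m" by (simp add: power_mult)
  ultimately show ?thesis
    by (simp add: central_ratio_def field_simps del: binomial_Suc_Suc mult_Suc_right)
qed

text \<open>With zero drift each step adds half the probability of being at \<open>0\<close>. The
  two parities are proved together because each follows from the other one step earlier.\<close>

lemma walk_mean_half:
  "(walk_step (1 / 2) ^^ (2 * m)) real 0 = (2 * real m + 1 / 2) * central_ratio m - 1 / 2"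
  "(walk_step (1 / 2) ^^ Suc (2 * m)) real 0 = (2 * real m + 1) * central_ratio m - 1 / 2"
proof (induction m)
  case 0
  show "(walk_step (1 / 2) ^^ (2 * 0)) real 0 = (2 * real 0 + 1 / 2) * central_ratio 0 - 1 / 2"
    by (simp add: central_ratio_def)
  show "(walk_step (1 / 2) ^^ Suc (2 * 0)) real 0 = (2 * real 0 + 1) * central_ratio 0 - 1 / 2"
    by (simp add: central_ratio_def walk_step_def)
next
  case (Suc m)
  have e: "(walk_step (1 / 2) ^^ (2 * k)) (\<lambda>i. of_bool (i = 0)) 0 = central_ratio k" for k
    unfolding funpow_walk_step_half_indicator by (simp add: central_ratio_def power_mult)
  have o: "(walk_step (1 / 2) ^^ Suc (2 * k)) (\<lambda>i. of_bool (i = 0)) 0 = central_ratio (Suc k)" for k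
    unfolding funpow_walk_step_half_indicator central_ratio_odd[symmetric] by simp
  have "(walk_step (1 / 2) ^^ (2 * Suc m)) real 0 = (walk_step (1 / 2) ^^ Suc (Suc (2 * m))) real 0"
    by (simp only: mult_Suc_right add_2_eq_Suc)
  also have "\<dots> = (2 * real m + 1) * central_ratio m - 1 / 2 + central_ratio (Suc m) / 2"
    unfolding funpow_walk_step_real_Suc[where n = "Suc (2 * m)"] o Suc by simp
  also have "\<dots> = (2 * real (Suc m) + 1 / 2) * central_ratio (Suc m) - 1 / 2"
    unfolding central_ratio_Suc[symmetric] by (simp add: algebra_simps)
  finally show "(walk_step (1 / 2) ^^ (2 * Suc m)) real 0
      = (2 * real (Suc m) + 1 / 2) * central_ratio (Suc m) - 1 / 2" .
  then show "(walk_step (1 / 2) ^^ Suc (2 * Suc m)) real 0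
      = (2 * real (Suc m) + 1) * central_ratio (Suc m) - 1 / 2"
    unfolding funpow_walk_step_real_Suc[where n = "2 * Suc m"] e by (simp add: algebra_simps)
qed

section \<open>Wallis' product and bounds for the central binomial coefficient\<close>

lemma central_ratio_square_Suc:
  "(2 * real (Suc m) + 1) * (central_ratio (Suc m))\<^sup>2 =
    ((2 * real m + 1) * (central_ratio m)\<^sup>2) *
      ((2 * real m + 1) * (2 * real m + 3) / (2 * real m + 2)\<^sup>2)"
proof -
  have "central_ratio (Suc m) = (2 * real m + 1) * central_ratio m / (2 * real m + 2)"
    using central_ratio_Suc[of m] by (simp add: field_simps)
  then show ?thesis
    by (simp only:) (simp add: power_divide power_mult_distrib power2_eq_square mult_ac)
qed

text \<open>The growth factor of the left side is the reciprocal of the next Wallis factor.\<close>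

lemma central_ratio_wallis:
  "(2 * real m + 1) * (central_ratio m)\<^sup>2 = 1 / (\<Prod>k=1..m. (4 * real k ^ 2) / (4 * real k ^ 2 - 1))"
proof (induction m)
  case (Suc m)
  have "(2 * real m + 1) * (2 * real m + 3) / (2 * real m + 2)\<^sup>2
      = (4 * real (Suc m) ^ 2 - 1) / (4 * real (Suc m) ^ 2)"
    by (intro arg_cong2[where f = "(/)"]) (simp_all add: power2_eq_square algebra_simps)
  then show ?case unfolding central_ratio_square_Suc Suc by simp
qed (simp add: central_ratio_def)

lemma central_ratio_wallis_limit:
  "(\<lambda>m. (2 * real m + 1) * (central_ratio m)\<^sup>2) \<longlonglongrightarrow> 2 / pi"
  unfolding central_ratio_wallis using tendsto_divide[OF tendsto_const wallis, of 1] by simp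

text \<open>The sequence \<open>(2 * real m + 1) * (central_ratio m)\<^sup>2\<close> decreases to
  \<open>2 / pi\<close>, so it stays above its limit.\<close>

lemma central_ratio_lower: "sqrt (2 / (pi * (2 * real m + 1))) \<le> central_ratio m"
proof -
  have "decseq (\<lambda>m. (2 * real m + 1) * (central_ratio m)\<^sup>2)"
  proof (rule decseq_SucI)
    fix m
    show "(2 * real (Suc m) + 1) * (central_ratio (Suc m))\<^sup>2
        \<le> (2 * real m + 1) * (central_ratio m)\<^sup>2"
      unfolding central_ratio_square_Suc
    proof (intro mult_left_le)
      have "(2 * real m + 1) * (2 * real m + 3) \<le> (2 * real m + 2)\<^sup>2"
        by (simp add: power2_eq_square algebra_simps)
      then show "(2 * real m + 1) * (2 * real m + 3) / (2 * real m + 2)\<^sup>2 \<le> 1"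
        by (subst divide_le_eq_1_pos) simp_all
    qed simp
  qed
  from decseq_ge[OF this central_ratio_wallis_limit, of m]
  have "2 \<le> (2 * real m + 1) * (central_ratio m)\<^sup>2 * pi"
    by (simp only: pos_divide_le_eq pi_gt_zero)
  moreover have "0 < pi * (2 * real m + 1)" by (intro mult_pos_pos) auto
  ultimately have "2 / (pi * (2 * real m + 1)) \<le> (central_ratio m)\<^sup>2"
    by (simp only: pos_divide_le_eq mult_ac)
  then show ?thesis using central_ratio_pos[of m] by (intro real_le_lsqrt) auto
qed

text \<open>With \<open>2 * real m\<close> in place of \<open>2 * real m + 1\<close> the sequence
  increases to the same limit and stays below it.\<close>

lemma central_ratio_upper:
  assumes m: "0 < m"
  shows "central_ratio m \<le> sqrt (2 / (pi * (2 * real m)))"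
proof -
  have "incseq (\<lambda>m. 2 * real m * (central_ratio m)\<^sup>2)"
  proof (rule incseq_SucI)
    fix m
    have "2 * real m * (central_ratio m)\<^sup>2
        \<le> ((2 * real m + 1) * central_ratio m)\<^sup>2 / (2 * real (Suc m))"
    proof -
      have "2 * real m * (central_ratio m)\<^sup>2 * (2 * real (Suc m))
          \<le> (2 * real m + 1)\<^sup>2 * (central_ratio m)\<^sup>2"
        by (simp add: algebra_simps power2_eq_square)
      then show ?thesis by (simp add: pos_le_divide_eq power_mult_distrib del: of_nat_Suc)
    qed
    also have "\<dots> = 2 * real (Suc m) * (central_ratio (Suc m))\<^sup>2"
      unfolding central_ratio_Suc[symmetric] by (simp add: power2_eq_square)
    finally show "2 * real m * (central_ratio m)\<^sup>2 \<le> 2 * real (Suc m) * (central_ratio (Suc m))\<^sup>2" .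
  qed
  moreover have "(\<lambda>m. 2 * real m * (central_ratio m)\<^sup>2) \<longlonglongrightarrow> 2 / pi"
  proof -
    have "(\<lambda>m. 2 * real m / (2 * real m + 1) * ((2 * real m + 1) * (central_ratio m)\<^sup>2))
        \<longlonglongrightarrow> 1 * (2 / pi)"
      by (intro tendsto_mult central_ratio_wallis_limit) real_asymp
    moreover have "2 * real m / (2 * real m + 1) * ((2 * real m + 1) * (central_ratio m)\<^sup>2)
        = 2 * real m * (central_ratio m)\<^sup>2" for m
      by (simp add: field_simps)
    ultimately show ?thesis by (simp only: mult_1_left)
  qed
  ultimately have "2 * real m * (central_ratio m)\<^sup>2 \<le> 2 / pi" by (rule incseq_le)
  then have "(central_ratio m)\<^sup>2 \<le> 2 / (pi * (2 * real m))" using m by (simp add: field_simps)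
  then show ?thesis by (rule real_le_rsqrt)
qed

section \<open>The symmetric case: asymptotics\<close>

text \<open>Relaxing \<open>n\<close> to \<open>n + 1\<close> and \<open>n - 1\<close> under the
  roots gives bounds valid for both parities. From \<open>n = 2\<close> on, the half index
  \<open>m\<close> is positive, as the upper bound requires.\<close>

lemma walk_mean_half_bounds:
  assumes "2 \<le> n"
  defines "x \<equiv> (walk_step (1 / 2) ^^ n) real 0 + 1 / 2"
  shows "real n * sqrt (2 / (pi * (real n + 1))) \<le> x"
    and "x \<le> (real n + 1 / 2) * sqrt (2 / (pi * (real n - 1)))"
proof -
  have "real n * sqrt (2 / (pi * (real n + 1))) \<le> x
      \<and> x \<le> (real n + 1 / 2) * sqrt (2 / (pi * (real n - 1)))"
  proof (cases "even n")
    case True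
    then obtain m where n: "n = 2 * m" by blast
    then have m: "0 < m" using assms by simp
    have x: "x = (2 * real m + 1 / 2) * central_ratio m"
      unfolding x_def n walk_mean_half by simp
    have "2 * real m * sqrt (2 / (pi * (2 * real m + 1))) \<le> (2 * real m + 1 / 2) * central_ratio m"
      using central_ratio_lower[of m] central_ratio_pos[of m] by (intro mult_mono) auto
    moreover have "sqrt (2 / (pi * (2 * real m))) \<le> sqrt (2 / (pi * (2 * real m - 1)))"
      using m by (intro real_sqrt_le_mono divide_left_mono mult_left_mono mult_pos_pos) auto
    with central_ratio_upper[OF m] have "central_ratio m \<le> sqrt (2 / (pi * (2 * real m - 1)))"
      by (rule order_trans)
    then have "(2 * real m + 1 / 2) * central_ratio m
        \<le> (2 * real m + 1 / 2) * sqrt (2 / (pi * (2 * real m - 1)))"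
      by (intro mult_left_mono) auto
    ultimately show ?thesis unfolding x by (simp add: n)
  next
    case False
    then obtain m where n: "n = Suc (2 * m)" using oddE by fastforce
    then have m: "0 < m" using assms by simp
    have x: "x = (2 * real m + 1) * central_ratio m"
      unfolding x_def n walk_mean_half by simp
    have "sqrt (2 / (pi * (2 * real m + 1 + 1))) \<le> sqrt (2 / (pi * (2 * real m + 1)))"
      by (intro real_sqrt_le_mono divide_left_mono mult_left_mono mult_pos_pos) auto
    from this central_ratio_lower[of m]
      have "sqrt (2 / (pi * (2 * real m + 1 + 1))) \<le> central_ratio m"
      by (rule order_trans)
    then have "(2 * real m + 1) * sqrt (2 / (pi * (2 * real m + 1 + 1)))
        \<le> (2 * real m + 1) * central_ratio m"
      by (intro mult_left_mono) auto
    moreover have "(2 * real m + 1) * central_ratio m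
        \<le> (2 * real m + 1 + 1 / 2) * sqrt (2 / (pi * (2 * real m)))"
      using central_ratio_upper[OF m] central_ratio_pos[of m] by (intro mult_mono) auto
    ultimately show ?thesis unfolding x by (simp add: n add_ac)
  qed
  then show "real n * sqrt (2 / (pi * (real n + 1))) \<le> x"
    and "x \<le> (real n + 1 / 2) * sqrt (2 / (pi * (real n - 1)))" by auto
qed

lemma walk_mean_drift_zero:
  "(\<lambda>n. (walk_step (1 / 2) ^^ n) real 0 - (sqrt (2 * real n / pi) - 1 / 2))
     \<in> O(\<lambda>n. real n powr (- 1 / 2))"
proof -
  let ?l = "\<lambda>n. real n * sqrt (2 / (pi * (real n + 1))) - sqrt (2 * real n / pi)"
  let ?u = "\<lambda>n. (real n + 1 / 2) * sqrt (2 / (pi * (real n - 1))) - sqrt (2 * real n / pi)"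
  have l: "?l \<in> O(\<lambda>n. real n powr (- 1 / 2))" by real_asymp
  have u: "?u \<in> O(\<lambda>n. real n powr (- 1 / 2))" by real_asymp
  have "(\<lambda>n. (walk_step (1 / 2) ^^ n) real 0 - (sqrt (2 * real n / pi) - 1 / 2))
      \<in> O(\<lambda>n. \<bar>?l n\<bar> + \<bar>?u n\<bar>)"
  proof (rule bigoI[of _ 1])
    show "\<forall>\<^sub>F n in at_top. norm ((walk_step (1 / 2) ^^ n) real 0 - (sqrt (2 * real n / pi) - 1 / 2))
        \<le> 1 * norm (\<bar>?l n\<bar> + \<bar>?u n\<bar>)"
      using eventually_ge_at_top[of 2]
    proof eventually_elim
      case (elim n)
      \<comment> \<open>Between two bounds, the distance to any \<open>s\<close> is at most the sum
        of the distances of the bounds to \<open>s\<close>.\<close>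
      have "\<bar>x - (s - 1 / 2)\<bar> \<le> 1 * \<bar>\<bar>a - s\<bar> + \<bar>b - s\<bar>\<bar>"
        if "a \<le> x + 1 / 2" "x + 1 / 2 \<le> b" for a b s x :: real
        using that by (auto simp: abs_if)
      from this[OF walk_mean_half_bounds[OF elim]] show ?case unfolding real_norm_def .
    qed
  qed
  also have "(\<lambda>n. \<bar>?l n\<bar> + \<bar>?u n\<bar>) \<in> O(\<lambda>n. real n powr (- 1 / 2))"
    using l u by (intro sum_in_bigo) simp_all
  finally show ?thesis .
qed

section \<open>Error terms, generating function and return to the chain\<close>

text \<open>This passes from an explicit bound at rate \<open>2 * sqrt (p * q)\<close> to the base
  enlarged by \<epsilon>.\<close>

lemma bigo_power_of_bound:
  fixes f :: "nat \<Rightarrow> real"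
  assumes "\<And>n. \<bar>f n\<bar> \<le> C * b ^ n" "0 \<le> b" "b \<le> c"
  shows "f \<in> O(\<lambda>n. c ^ n)"
proof (rule bigoI[of _ "\<bar>C\<bar>"], rule always_eventually, rule allI)
  fix n
  have "\<bar>f n\<bar> \<le> \<bar>C\<bar> * b ^ n"
    using assms(1)[of n] assms(2) by (smt (verit) mult_right_mono zero_le_power)
  also have "\<dots> \<le> \<bar>C\<bar> * c ^ n"
    using assms by (intro mult_left_mono power_mono) auto
  finally show "norm (f n) \<le> \<bar>C\<bar> * norm (c ^ n)"
    using assms by simp
qed

text \<open>The recurrence for the means, read coefficientwise, is a linear equation for the series;
  it is solved by multiplying with the inverse of \<open>1 - fps_X\<close>. The constant
  coefficients match because the walk starts at \<open>0\<close>.\<close>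

lemma walk_mean_gf:
  fixes p :: real
  shows "Abs_fps (\<lambda>n. (walk_step p ^^ n) real 0) =
    fps_const (1 - p) * fps_X
      * Abs_fps (\<lambda>n. (walk_step p ^^ n) (\<lambda>k. of_bool (k = 0)) 0) / (1 - fps_X)
    + fps_const (2 * p - 1) * fps_X / (1 - fps_X) ^ 2"
  (is "?m = fps_const _ * _ * ?z / _ + _")
proof -
  let ?i = "inverse (1 - fps_X :: real fps)"
  have i: "?i = Abs_fps (\<lambda>_. 1)"
    by (rule fps_inverse_unique) (simp add: fps_eq_iff fps_mult_fps_X_commute left_diff_distrib)
  have ii: "(1 - fps_X) * ?i = 1"
    by (rule inverse_mult_eq_1') simp
  have "?m = fps_X * (?m + fps_const (2 * p - 1) * ?i + fps_const (1 - p) * ?z)"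
  proof (rule fps_ext)
    fix n
    show "fps_nth ?m n =
        fps_nth (fps_X * (?m + fps_const (2 * p - 1) * ?i + fps_const (1 - p) * ?z)) n"
    proof (cases n)
      case (Suc k)
      have "fps_nth ?m (Suc k) = (walk_step p ^^ Suc k) real 0" by simp
      then show ?thesis unfolding Suc funpow_walk_step_real_Suc by (simp add: i)
    qed simp
  qed
  moreover have "(1 - x) * y = x * (a + b)" if "y = x * (y + a + b)" for x y a b :: "real fps"
  proof -
    have "(1 - x) * y = y - x * y" by (simp add: algebra_simps)
    also have "\<dots> = x * (y + a + b) - x * y" using that by (rule arg_cong)
    also have "\<dots> = x * (a + b)" by (simp add: algebra_simps)
    finally show ?thesis .
  qed
  ultimately have "(1 - fps_X) * ?m = fps_X * (fps_const (2 * p - 1) * ?i + fps_const (1 - p) * ?z)"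
    by blast
  then have "?i * ((1 - fps_X) * ?m)
      = ?i * (fps_X * (fps_const (2 * p - 1) * ?i + fps_const (1 - p) * ?z))"
    by (rule arg_cong)
  moreover have "?i * ((1 - fps_X) * ?m) = (1 - fps_X) * ?i * ?m"
    by (simp only: mult_ac)
  ultimately have m: "?m = ?i * (fps_X * (fps_const (2 * p - 1) * ?i + fps_const (1 - p) * ?z))"
    unfolding ii by simp
  have "f / (1 - fps_X) = f * ?i" and "f / (1 - fps_X) ^ 2 = f * ?i * ?i" for f :: "real fps"
    by (simp_all add: fps_divide_unit power2_eq_square fps_inverse_mult mult.assoc)
  then show ?thesis
    by (subst m) (simp only: ring_distribs mult_ac add_ac)
qed

theorem proposition3p3:
  fixes p q :: real and M :: "'a measure" and S :: "nat \<Rightarrow> 'a \<Rightarrow> nat"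
  assumes "0 < p" and "p < 1" and "q = 1 - p"
    and "stratum_chain M p S"
  shows "stratum_mean_gf M S =
           fps_const q * fps_X * stratum_zero_gf M S / (1 - fps_X)
           + fps_const (p - q) * fps_X / (1 - fps_X) ^ 2 \<and>
         (p < 1 / 2 \<longrightarrow> (\<forall>\<epsilon>>0.
           (\<lambda>n. stratum_mean M S n - p / (q - p)) \<in> O(\<lambda>n. (2 * sqrt (p * q) + \<epsilon>) ^ n))) \<and>
         (p = 1 / 2 \<longrightarrow>
           (\<lambda>n. stratum_mean M S n - (sqrt (2 * real n / pi) - 1 / 2))
             \<in> O(\<lambda>n. real n powr (- 1 / 2))) \<and>
         (p > 1 / 2 \<longrightarrow> (\<forall>\<epsilon>>0.
           (\<lambda>n. stratum_mean M S n - ((p - q) * real n + q / (p - q)))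
             \<in> O(\<lambda>n. (2 * sqrt (p * q) + \<epsilon>) ^ n)))"
proof -
  interpret prob_space M using assms by (simp add: stratum_chain_def)
  have [measurable]: "S i \<in> measurable M (count_space UNIV)" for i
    using assms by (simp add: stratum_chain_def)
  have E: "(\<integral>\<omega>. f (S n \<omega>) \<partial>M) = (walk_step p ^^ n) f 0" for f n
    using assms by (intro stratum_chain_expectation) auto
  have mean: "stratum_mean M S = (\<lambda>n. (walk_step p ^^ n) real 0)"
    unfolding stratum_mean_def E ..
  have zero: "\<P>(\<omega> in M. S n \<omega> = 0) = (walk_step p ^^ n) (\<lambda>k. of_bool (k = 0)) 0" for n
  proof -
    \<comment> \<open>The probability of state \<open>0\<close> is the expectation of an indicator,
      so it too becomes an iterate of the operator.\<close>
    have "(\<integral>\<omega>. (of_bool (S n \<omega> = 0) :: real) \<partial>M) = (\<integral>\<omega>. indicator {\<omega> \<in> space M. S n \<omega> = 0} \<omega> \<partial>M)"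
      by (intro Bochner_Integration.integral_cong) (auto simp: indicator_def)
    then show ?thesis unfolding E[symmetric] by simp
  qed
  have pq: "1 - p = q" "2 * p - 1 = p - q" using assms by simp_all
  have "stratum_mean_gf M S = fps_const q * fps_X * stratum_zero_gf M S / (1 - fps_X)
      + fps_const (p - q) * fps_X / (1 - fps_X) ^ 2"
    unfolding stratum_mean_gf_def stratum_zero_gf_def mean zero
    by (rule walk_mean_gf[of p, unfolded pq])
  moreover have "(\<lambda>n. stratum_mean M S n - p / (q - p)) \<in> O(\<lambda>n. (2 * sqrt (p * q) + \<epsilon>) ^ n)"
    if "p < 1 / 2" "\<epsilon> > 0" for \<epsilon>
    unfolding mean assms(3)
    by (rule bigo_power_of_bound[OF walk_mean_drift_neg[OF assms(1) that(1)]])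
      (use that assms in auto)
  moreover have "(\<lambda>n. stratum_mean M S n - (sqrt (2 * real n / pi) - 1 / 2))
      \<in> O(\<lambda>n. real n powr (- 1 / 2))" if "p = 1 / 2"
    unfolding mean that by (rule walk_mean_drift_zero)
  moreover have "(\<lambda>n. stratum_mean M S n - ((p - q) * real n + q / (p - q)))
      \<in> O(\<lambda>n. (2 * sqrt (p * q) + \<epsilon>) ^ n)" if "p > 1 / 2" "\<epsilon> > 0" for \<epsilon>
    unfolding mean assms(3)
    by (rule bigo_power_of_bound[OF walk_mean_drift_pos[OF that(1) assms(2)]])
      (use that assms in auto)
  ultimately show ?thesis by blast
qed

end
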